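(* Let $\Omega$ be a bounded domain of $\mathbb{R}^N$, and let $L=L(x,u,z)\in \mathrm{C}^2(\Omega\times\mathbb{R}\times\mathbb{R}^N)\cap \mathrm{C}^1(\overline\Omega\times\mathbb{R}\times\mathbb{R}^N)$ be a real-valued Lagrangian satisfying, for all $x\in\Omega$ and $u\in\mathbb{R}$, $$\sum_{i=1}^N L_{x_iz_i}(x,u,0)=0\qquad\text{and}\qquad L_{x_iu}(x,u,0)=0\ \text{ for all } i=1,\dots,N.$$ Let $u\in \mathrm{C}^2(\Omega)\cap \mathrm{C}^1(\overline\Omega)$ be a real-valued non-trivial classical solution of Noether's equations $$\sum_{j=1}^N\frac{\partial}{\partial x_j}\big[T_{ij}(x,u(x),Du(x))\big]+L_{x_i}(x,u(x),Du(x))=0\quad\text{for all }x\in\Omega,\ i=1,\dots,N.$$ If the set $\mathrm{A}_0:=\{x\in\Omega:\ Du(x)=0\}$ has an interior point, then $L_u(x,u(x),Du(x))=0$ for all $x$ in the interior of $\mathrm{A}_0$.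
   Context: A domain is an open connected subset of $\mathbb{R}^N$. $\mathrm{C}^1(\overline\Omega)$ denotes the set of restrictions to $\Omega$ of continuously differentiable functions on $\mathbb{R}^N$, and similarly $\mathrm{C}^1(\overline\Omega\times\mathbb{R}\times\mathbb{R}^N)$. Subscripts on $L$ denote partial derivatives with respect to the independent variables $x\in\Omega$, $u\in\mathbb{R}$, $z\in\mathbb{R}^N$ ($z$ is the slot for $Du$); $\frac{\partial}{\partial x_j}[\cdots]$ denotes the derivative of the composed function of $x$. The energy-momentum tensor is $T_{ij}(x,u,z)=z_iL_{z_j}(x,u,z)-\delta_{ij}L(x,u,z)$. A function $u$ is called non-trivial if $Du$ is not identically $0$ in $\Omega$. *)

theory Defs
  imports "HOL-Analysis.Analysis"
begin

definition partial_deriv :: "'a::euclidean_space \<Rightarrow> ('a \<Rightarrow> real) \<Rightarrow> 'a \<Rightarrow> real" where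
  "partial_deriv b f x = deriv (\<lambda>t. f (x + t *\<^sub>R b)) 0"

(* Intended for open S, where derivatives at points of S depend only on the values of f on S. *)
primrec Ck_on :: "nat \<Rightarrow> 'a::euclidean_space set \<Rightarrow> ('a \<Rightarrow> real) \<Rightarrow> bool" where
  "Ck_on 0 S f \<longleftrightarrow> continuous_on S f"
| "Ck_on (Suc k) S f \<longleftrightarrow>
     (\<forall>x\<in>S. f differentiable (at x)) \<and> (\<forall>b\<in>Basis. Ck_on k S (partial_deriv b f))"

(* f belongs to C^1 of the closure of S in the sense that f, on S, is the restriction of a
   continuously differentiable function on the whole space. *)
definition C1_closure :: "'a::euclidean_space set \<Rightarrow> ('a \<Rightarrow> real) \<Rightarrow> bool" where
  "C1_closure S f \<longleftrightarrow> (\<exists>g. Ck_on 1 UNIV g \<and> (\<forall>x\<in>S. g x = f x))"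

definition grad :: "(real^'n \<Rightarrow> real) \<Rightarrow> real^'n \<Rightarrow> real^'n" where
  "grad u x = (\<chi> j. partial_deriv (axis j 1) u x)"

text \<open>A Lagrangian is a function of the triple \<open>(x, u, z)\<close>; its partial derivatives in the three
  groups of variables are again functions of the triple.\<close>

type_synonym 'n lagrangian = "(real^'n) \<times> real \<times> (real^'n) \<Rightarrow> real"

definition deriv_x :: "'n::finite \<Rightarrow> 'n lagrangian \<Rightarrow> 'n lagrangian" where
  "deriv_x i L = partial_deriv (axis i 1, 0, 0) L"

definition deriv_u :: "'n::finite lagrangian \<Rightarrow> 'n lagrangian" where
  "deriv_u L = partial_deriv (0, 1, 0) L"

definition deriv_z :: "'n::finite \<Rightarrow> 'n lagrangian \<Rightarrow> 'n lagrangian" where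
  "deriv_z i L = partial_deriv (0, 0, axis i 1) L"

definition energy_momentum :: "'n::finite lagrangian \<Rightarrow> 'n \<Rightarrow> 'n \<Rightarrow> 'n lagrangian" where
  "energy_momentum L i j = (\<lambda>(x, u, z).
     z $ i * deriv_z j L (x, u, z) - (if i = j then 1 else 0) * L (x, u, z))"

definition noether_solution ::
  "(real^'n::finite) set \<Rightarrow> 'n lagrangian \<Rightarrow> (real^'n \<Rightarrow> real) \<Rightarrow> bool" where
  "noether_solution \<Omega> L u \<longleftrightarrow> (\<forall>x\<in>\<Omega>. \<forall>i.
     (\<Sum>j\<in>UNIV. partial_deriv (axis j 1) (\<lambda>y. energy_momentum L i j (y, u y, grad u y)) x)
       + deriv_x i L (x, u x, grad u x) = 0)"

end

theory Submission
  imports Defs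
begin

text \<open>By the chain rule, Noether's equations say \<open>E Du = 0\<close> in \<open>\<Omega>\<close>, where \<open>E\<close> is the continuous
  Euler--Lagrange expression \<open>div L\<^sub>z - L\<^sub>u\<close> along \<open>u\<close>; so \<open>E\<close> vanishes off \<open>A\<^sub>0\<close>. In the interior of
  \<open>A\<^sub>0\<close> the two structural assumptions reduce \<open>E\<close> to \<open>-L\<^sub>u\<close> and show that it is locally
  constant. Hence for \<open>v \<noteq> 0\<close> the level set \<open>{E = v}\<close> lies in the interior of \<open>A\<^sub>0\<close> and is both
  open and closed in the connected set \<open>\<Omega>\<close>. It is not all of \<open>\<Omega>\<close> because \<open>u\<close> is non-trivial, so it
  is empty.\<close>

section \<open>Partial derivatives and their symmetry\<close>

lemma has_real_derivative_line:
  assumes "(f has_derivative f') (at (x + s *\<^sub>R b))"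
  shows "((\<lambda>t. f (x + t *\<^sub>R b)) has_real_derivative f' b) (at s)"
proof -
  have "((\<lambda>t. f (x + t *\<^sub>R b)) has_derivative (\<lambda>t. f' (t *\<^sub>R b))) (at s)"
    by (rule has_derivative_compose[where f = "\<lambda>t. x + t *\<^sub>R b" and g = f and g' = f'])
       (auto intro!: derivative_eq_intros assms)
  moreover have "(\<lambda>t. f' (t *\<^sub>R b)) = (*) (f' b)"
    using linear_scale[OF has_derivative_linear[OF assms]] by (auto simp: mult.commute)
  ultimately show ?thesis
    by (simp add: has_field_derivative_def)
qed

lemma partial_deriv_has_derivative:
  assumes "(f has_derivative f') (at x)"
  shows "partial_deriv b f x = f' b"
  unfolding partial_deriv_def
  by (rule DERIV_imp_deriv, rule has_real_derivative_line) (simp add: assms)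

lemma has_real_derivative_along:
  assumes "f differentiable (at (x + s *\<^sub>R b))"
  shows "((\<lambda>t. f (x + t *\<^sub>R b)) has_real_derivative partial_deriv b f (x + s *\<^sub>R b)) (at s)"
  using assms has_real_derivative_line partial_deriv_has_derivative
  unfolding differentiable_def by metis

lemma partial_deriv_cong:
  assumes "\<forall>\<^sub>F y in nhds x. f y = g y"
  shows "partial_deriv b f x = partial_deriv b g x"
proof -
  have "((\<lambda>t. x + t *\<^sub>R b) \<longlongrightarrow> x + 0 *\<^sub>R b) (nhds 0)"
    by (intro tendsto_intros filterlim_ident)
  with assms have "\<forall>\<^sub>F t in nhds 0. f (x + t *\<^sub>R b) = g (x + t *\<^sub>R b)"
    by (auto simp: filterlim_iff)
  then show ?thesis
    unfolding partial_deriv_def by (rule deriv_cong_ev) simp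
qed

lemma Ck_on_2_iff:
  "Ck_on 2 S f \<longleftrightarrow> (\<forall>x\<in>S. f differentiable (at x)) \<and>
    (\<forall>b\<in>Basis. (\<forall>x\<in>S. partial_deriv b f differentiable (at x)) \<and>
      (\<forall>c\<in>Basis. continuous_on S (partial_deriv c (partial_deriv b f))))"
  by (simp add: numeral_2_eq_2)

text \<open>The mean value theorem is applied twice: along \<open>b\<close> to the increment of
  \<open>f\<close> in direction \<open>c\<close>, then along \<open>c\<close> to
  \<open>partial_deriv b f\<close>. The second difference is symmetric in \<open>b\<close> and
  \<open>c\<close>, which later identifies the two mixed derivatives.\<close>

lemma second_difference_mean_value:
  fixes f :: "'a::euclidean_space \<Rightarrow> real"
  assumes b: "b \<in> Basis" and c: "c \<in> Basis" and h: "0 < h"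
    and ball: "cball x (2 * h) \<subseteq> S"
    and f: "\<And>y. y \<in> S \<Longrightarrow> f differentiable (at y)"
    and fb: "\<And>y. y \<in> S \<Longrightarrow> partial_deriv b f differentiable (at y)"
  obtains p where "dist x p \<le> 2 * h"
    and "f (x + h *\<^sub>R b + h *\<^sub>R c) - f (x + h *\<^sub>R b) - f (x + h *\<^sub>R c) + f x
      = h * h * partial_deriv c (partial_deriv b f) p"
proof -
  \<comment> \<open>Basis vectors have norm one, so these points are at distance at most
    \<open>s + t\<close> from \<open>x\<close>; this is where the radius \<open>2 * h\<close> comes
    from.\<close>
  have near: "dist x (x + s *\<^sub>R b + t *\<^sub>R c) \<le> 2 * h"
    if "0 \<le> s" "s \<le> h" "0 \<le> t" "t \<le> h" for s t
  proof -
    have "norm (s *\<^sub>R b + t *\<^sub>R c) \<le> norm (s *\<^sub>R b) + norm (t *\<^sub>R c)"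
      by (rule norm_triangle_ineq)
    also have "\<dots> \<le> 2 * h"
      using that b c by simp
    finally show ?thesis
      by (metis add.assoc add_diff_cancel_left' dist_commute dist_norm)
  qed
  then have mem: "x + s *\<^sub>R b + t *\<^sub>R c \<in> S"
    if "0 \<le> s" "s \<le> h" "0 \<le> t" "t \<le> h" for s t
    using that ball by (auto simp: mem_cball)
  have mem0: "x + s *\<^sub>R b \<in> S" if "0 \<le> s" "s \<le> h" for s
    using mem[of s 0] that h by simp
  \<comment> \<open>With this choice \<open>\<phi> h - \<phi> 0\<close> is exactly the second
    difference.\<close>
  define \<phi> where "\<phi> s = f ((x + h *\<^sub>R c) + s *\<^sub>R b) - f (x + s *\<^sub>R b)" for s
  have "(\<phi> has_real_derivative
      partial_deriv b f ((x + h *\<^sub>R c) + s *\<^sub>R b) - partial_deriv b f (x + s *\<^sub>R b)) (at s)"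
    if "0 \<le> s" "s \<le> h" for s
    unfolding \<phi>_def
    using mem[of s h] mem0[of s] that h
    by (intro DERIV_diff has_real_derivative_along f) (simp_all add: add_ac)
  from MVT2[OF h this] obtain \<xi> where \<xi>: "0 < \<xi>" "\<xi> < h"
    and 1: "\<phi> h - \<phi> 0 = h *
      (partial_deriv b f ((x + h *\<^sub>R c) + \<xi> *\<^sub>R b) - partial_deriv b f (x + \<xi> *\<^sub>R b))"
    by auto
  have "((\<lambda>t. partial_deriv b f ((x + \<xi> *\<^sub>R b) + t *\<^sub>R c)) has_real_derivative
      partial_deriv c (partial_deriv b f) ((x + \<xi> *\<^sub>R b) + t *\<^sub>R c)) (at t)"
    if "0 \<le> t" "t \<le> h" for t
    using mem[of \<xi> t] that \<xi> by (intro has_real_derivative_along fb) simp_all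
  from MVT2[OF h this] obtain \<eta> where \<eta>: "0 < \<eta>" "\<eta> < h"
    and 2: "partial_deriv b f ((x + \<xi> *\<^sub>R b) + h *\<^sub>R c) - partial_deriv b f (x + \<xi> *\<^sub>R b) =
      h * partial_deriv c (partial_deriv b f) ((x + \<xi> *\<^sub>R b) + \<eta> *\<^sub>R c)"
    by auto
  show thesis
  proof (rule that)
    show "dist x (x + \<xi> *\<^sub>R b + \<eta> *\<^sub>R c) \<le> 2 * h"
      using near \<xi> \<eta> by simp
    show "f (x + h *\<^sub>R b + h *\<^sub>R c) - f (x + h *\<^sub>R b) - f (x + h *\<^sub>R c) + f x
      = h * h * partial_deriv c (partial_deriv b f) (x + \<xi> *\<^sub>R b + \<eta> *\<^sub>R c)"
      using 1 2 by (simp add: \<phi>_def add_ac)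
  qed
qed

text \<open>The intermediate points given by the mean value theorem lie within
  \<open>2 * h n\<close> of \<open>x\<close>, hence converge to \<open>x\<close>, where the mixed
  derivative is continuous.\<close>

lemma second_difference_tendsto:
  fixes f :: "'a::euclidean_space \<Rightarrow> real"
  assumes S: "open S" "x \<in> S" and f: "Ck_on 2 S f" and b: "b \<in> Basis" and c: "c \<in> Basis"
    and h: "\<And>n. 0 < h n" "\<And>n. cball x (2 * h n) \<subseteq> S" "h \<longlonglongrightarrow> 0"
  shows "(\<lambda>n. (f (x + h n *\<^sub>R b + h n *\<^sub>R c) - f (x + h n *\<^sub>R b) - f (x + h n *\<^sub>R c) + f x)
    / (h n * h n)) \<longlonglongrightarrow> partial_deriv c (partial_deriv b f) x"
proof -
  let ?D = "\<lambda>n. f (x + h n *\<^sub>R b + h n *\<^sub>R c) - f (x + h n *\<^sub>R b) - f (x + h n *\<^sub>R c) + f x"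
  have diff: "\<And>y. y \<in> S \<Longrightarrow> f differentiable (at y)"
    "\<And>y. y \<in> S \<Longrightarrow> partial_deriv b f differentiable (at y)"
    using f b by (auto simp: Ck_on_2_iff)
  have "\<exists>p. dist x p \<le> 2 * h n \<and> ?D n = h n * h n * partial_deriv c (partial_deriv b f) p" for n
    using second_difference_mean_value[OF b c h(1,2) diff, of n] by blast
  then obtain p where p: "\<And>n. dist x (p n) \<le> 2 * h n"
    "\<And>n. ?D n = h n * h n * partial_deriv c (partial_deriv b f) (p n)"
    by metis
  have "(\<lambda>n. dist (p n) x) \<longlonglongrightarrow> 0"
  proof (rule tendsto_sandwich[OF _ _ tendsto_const])
    show "(\<lambda>n. 2 * h n) \<longlonglongrightarrow> 0"
      by (intro tendsto_mult_right_zero h(3))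
  qed (use p(1) in \<open>simp_all add: dist_commute\<close>)
  then have "p \<longlonglongrightarrow> x"
    by (rule tendsto_dist_iff[THEN iffD2])
  moreover have "isCont (partial_deriv c (partial_deriv b f)) x"
    using f b c S continuous_on_eq_continuous_at unfolding Ck_on_2_iff by blast
  ultimately have "(\<lambda>n. partial_deriv c (partial_deriv b f) (p n))
      \<longlonglongrightarrow> partial_deriv c (partial_deriv b f) x"
    by (rule isCont_tendsto_compose[rotated])
  moreover have "?D n / (h n * h n) = partial_deriv c (partial_deriv b f) (p n)" for n
    unfolding p(2) using h(1)[of n] by simp
  ultimately show ?thesis
    by simp
qed

text \<open>Schwarz's theorem. Exchanging \<open>b\<close> and \<open>c\<close> leaves the second
  difference quotient unchanged, and both mixed derivatives are its limit along the same sequence of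
  step sizes.\<close>

lemma partial_deriv_commute:
  fixes f :: "'a::euclidean_space \<Rightarrow> real"
  assumes S: "open S" "x \<in> S" and f: "Ck_on 2 S f" and b: "b \<in> Basis" and c: "c \<in> Basis"
  shows "partial_deriv b (partial_deriv c f) x = partial_deriv c (partial_deriv b f) x"
proof -
  obtain r where r: "0 < r" "cball x r \<subseteq> S"
    using S open_contains_cball by blast
  \<comment> \<open>The factor \<open>r / 2\<close> yields \<open>2 * h n \<le> r\<close> for every
    \<open>n\<close>, so the closed balls of radius \<open>2 * h n\<close> stay inside
    \<open>S\<close>.\<close>
  define h :: "nat \<Rightarrow> real" where "h n = (r / 2) * inverse (real (Suc n))" for n
  have h: "0 < h n" "2 * h n \<le> r" for n
    using r by (auto simp: h_def field_simps)
  have "cball x (2 * h n) \<subseteq> S" for n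
    using r h(2)[of n] by (meson order_trans subset_cball)
  moreover have "h \<longlonglongrightarrow> 0"
    unfolding h_def by (intro tendsto_mult_right_zero LIMSEQ_inverse_real_of_nat)
  ultimately have "(\<lambda>n. (f (x + h n *\<^sub>R b + h n *\<^sub>R c) - f (x + h n *\<^sub>R b) - f (x + h n *\<^sub>R c) + f x)
      / (h n * h n)) \<longlonglongrightarrow> partial_deriv c (partial_deriv b f) x"
    and "(\<lambda>n. (f (x + h n *\<^sub>R c + h n *\<^sub>R b) - f (x + h n *\<^sub>R c) - f (x + h n *\<^sub>R b) + f x)
      / (h n * h n)) \<longlonglongrightarrow> partial_deriv b (partial_deriv c f) x"
    using second_difference_tendsto[OF S f] b c h(1) by blast+
  moreover have "f (x + h n *\<^sub>R c + h n *\<^sub>R b) - f (x + h n *\<^sub>R c) - f (x + h n *\<^sub>R b) + f x =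
      f (x + h n *\<^sub>R b + h n *\<^sub>R c) - f (x + h n *\<^sub>R b) - f (x + h n *\<^sub>R c) + f x" for n
    by (simp add: add.assoc add.commute[of "h n *\<^sub>R c"])
  ultimately show ?thesis
    by (simp add: LIMSEQ_unique)
qed

text \<open>A linear map is determined by its values on the basis. This turns information on partial
  derivatives into the total derivative, from which constancy on a ball follows.\<close>

lemma has_derivative_zero_if_partial_deriv_zero:
  fixes f :: "'a::euclidean_space \<Rightarrow> real"
  assumes "f differentiable (at x)" and "\<And>b. b \<in> Basis \<Longrightarrow> partial_deriv b f x = 0"
  shows "(f has_derivative (\<lambda>_. 0)) (at x)"
proof -
  obtain f' where f': "(f has_derivative f') (at x)"
    using assms(1) by (auto simp: differentiable_def)
  have "f' = (\<lambda>_. 0)"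
    by (rule linear_eq_stdbasis[OF has_derivative_linear[OF f']])
       (use assms(2) partial_deriv_has_derivative[OF f'] in \<open>auto simp: linear_zero\<close>)
  with f' show ?thesis
    by simp
qed

section \<open>Composition with the one-jet of a function\<close>

abbreviation (input) jet :: "(real^'n::finite \<Rightarrow> real) \<Rightarrow> real^'n \<Rightarrow> (real^'n) \<times> real \<times> (real^'n)" where
  "jet u y \<equiv> (y, u y, grad u y)"

text \<open>The jet is differentiated slot by slot, and the gradient slot componentwise. The values
  of \<open>J\<close> on the axis vectors are recorded because the chain rule is needed in exactly
  those directions.\<close>

lemma has_derivative_jet:
  fixes u :: "real^'n::finite \<Rightarrow> real"
  assumes "Ck_on 2 \<Omega> u" and "x \<in> \<Omega>"
  obtains J where "(jet u has_derivative J) (at x)"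
    and "\<And>j. J (axis j 1) = (axis j 1, partial_deriv (axis j 1) u x,
      \<chi> k. partial_deriv (axis j 1) (partial_deriv (axis k 1) u) x)"
proof -
  obtain u' where u': "(u has_derivative u') (at x)"
    using assms by (auto simp: Ck_on_2_iff differentiable_def)
  have "\<exists>v'. (partial_deriv (axis k 1) u has_derivative v') (at x)" for k
    using assms by (auto simp: Ck_on_2_iff differentiable_def axis_in_Basis_iff)
  then obtain v' where v': "\<And>k. (partial_deriv (axis k 1) u has_derivative v' k) (at x)"
    by metis
  have "(grad u has_derivative (\<lambda>d. \<chi> k. v' k d)) (at x)"
    by (subst has_derivative_componentwise_within) (auto simp: Basis_vec_def inner_axis grad_def v')
  with u' have "(jet u has_derivative (\<lambda>d. (d, u' d, \<chi> k. v' k d))) (at x)"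
    by (intro has_derivative_Pair has_derivative_ident)
  then show thesis
    by (rule that) (simp add: partial_deriv_has_derivative[OF u'] partial_deriv_has_derivative[OF v'])
qed

lemma differentiable_compose_jet:
  fixes u :: "real^'n::finite \<Rightarrow> real"
  assumes "Ck_on 2 \<Omega> u" and "x \<in> \<Omega>" and "g differentiable (at (jet u x))"
  shows "(\<lambda>y. g (jet u y)) differentiable (at x)"
proof -
  obtain J where "(jet u has_derivative J) (at x)"
    using has_derivative_jet[OF assms(1,2)] .
  moreover obtain g' where "(g has_derivative g') (at (jet u x))"
    using assms(3) by (auto simp: differentiable_def)
  ultimately show ?thesis
    by (rule differentiableI[OF has_derivative_compose])
qed

lemma partial_deriv_compose_jet:
  fixes u :: "real^'n::finite \<Rightarrow> real"
  assumes "Ck_on 2 \<Omega> u" and "x \<in> \<Omega>" and "g differentiable (at (jet u x))"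
  shows "partial_deriv (axis j 1) (\<lambda>y. g (jet u y)) x = deriv_x j g (jet u x)
    + partial_deriv (axis j 1) u x * deriv_u g (jet u x)
    + (\<Sum>k\<in>UNIV. partial_deriv (axis j 1) (partial_deriv (axis k 1) u) x * deriv_z k g (jet u x))"
proof -
  obtain J where J: "(jet u has_derivative J) (at x)"
    and J_axis: "\<And>j. J (axis j 1) = (axis j 1, partial_deriv (axis j 1) u x,
      \<chi> k. partial_deriv (axis j 1) (partial_deriv (axis k 1) u) x)"
    by (rule has_derivative_jet[OF assms(1,2)]) blast
  obtain g' where g': "(g has_derivative g') (at (jet u x))"
    using assms(3) by (auto simp: differentiable_def)
  interpret g': linear g'
    by (rule has_derivative_linear[OF g'])
  \<comment> \<open>The vector \<open>J (axis j 1)\<close> is resolved into the directions of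
    \<open>deriv_x j\<close>, \<open>deriv_u\<close> and \<open>deriv_z k\<close>. Its first slot is
    already a single axis vector, so only the last slot has to be expanded.\<close>
  have split: "(a, r, w) = (a, 0, 0) + r *\<^sub>R (0, 1, 0)
      + (\<Sum>k\<in>UNIV. w $ k *\<^sub>R ((0, 0, axis k 1) :: (real^'n) \<times> real \<times> (real^'n)))"
    for a r and w :: "real^'n"
    using basis_expansion[of w]
    by (simp add: prod_eq_iff fst_sum snd_sum scalar_mult_eq_scaleR)
  have "partial_deriv (axis j 1) (\<lambda>y. g (jet u y)) x = g' (J (axis j 1))"
    by (rule partial_deriv_has_derivative) (rule has_derivative_compose[OF J g'])
  also have "\<dots> = deriv_x j g (jet u x) + partial_deriv (axis j 1) u x * deriv_u g (jet u x)
    + (\<Sum>k\<in>UNIV. partial_deriv (axis j 1) (partial_deriv (axis k 1) u) x * deriv_z k g (jet u x))"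
    unfolding J_axis deriv_x_def deriv_u_def deriv_z_def partial_deriv_has_derivative[OF g']
    by (subst split) (simp only: g'.add g'.scale g'.sum vec_lambda_beta real_scaleR_def)
  finally show ?thesis .
qed

section \<open>The Euler-Lagrange expression and its relation to Noether's equations\<close>

definition euler_lagrange :: "'n::finite lagrangian \<Rightarrow> (real^'n \<Rightarrow> real) \<Rightarrow> real^'n \<Rightarrow> real" where
  "euler_lagrange L u x =
    (\<Sum>j\<in>UNIV. partial_deriv (axis j 1) (\<lambda>y. deriv_z j L (jet u y)) x) - deriv_u L (jet u x)"

context
  fixes \<Omega> :: "(real^'n::finite) set" and L :: "'n lagrangian" and u :: "real^'n \<Rightarrow> real"
  assumes \<Omega>: "open \<Omega>"
    and L: "Ck_on 2 (\<Omega> \<times> UNIV \<times> UNIV) L"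
    and u: "Ck_on 2 \<Omega> u"
begin

lemma Basis_lagrangian:
  "(axis i 1, 0, 0) \<in> (Basis :: ((real^'n) \<times> real \<times> (real^'n)) set)"
  "(0, 1, 0) \<in> (Basis :: ((real^'n) \<times> real \<times> (real^'n)) set)"
  "(0, 0, axis i 1) \<in> (Basis :: ((real^'n) \<times> real \<times> (real^'n)) set)"
  by (auto simp: Basis_prod_def axis_in_Basis_iff image_iff zero_prod_def)

lemma differentiable_lagrangian:
  assumes "x \<in> \<Omega>"
  shows "L differentiable (at (x, s, z))"
    and "deriv_u L differentiable (at (x, s, z))"
    and "deriv_z i L differentiable (at (x, s, z))"
proof -
  have "(x, s, z) \<in> \<Omega> \<times> UNIV \<times> UNIV"
    using assms by simp
  with L Basis_lagrangian show "L differentiable (at (x, s, z))"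
    and "deriv_u L differentiable (at (x, s, z))"
    and "deriv_z i L differentiable (at (x, s, z))"
    unfolding Ck_on_2_iff deriv_u_def deriv_z_def by blast+
qed

text \<open>The structural assumptions differentiate \<open>L\<close> in \<open>x\<close> first,
  whereas the chain rule for \<open>deriv_u L\<close> and \<open>deriv_z j L\<close> along the jet
  differentiates in \<open>x\<close> last; this reconciles the two orders.\<close>

lemma deriv_commute:
  assumes "x \<in> \<Omega>"
  shows "deriv_x i (deriv_u L) (x, s, z) = deriv_u (deriv_x i L) (x, s, z)"
    and "deriv_x i (deriv_z j L) (x, s, z) = deriv_z j (deriv_x i L) (x, s, z)"
proof -
  have "open (\<Omega> \<times> (UNIV :: real set) \<times> (UNIV :: (real^'n) set))"
    by (intro open_Times \<Omega> open_UNIV)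
  from partial_deriv_commute[OF this _ L] assms
  show "deriv_x i (deriv_u L) (x, s, z) = deriv_u (deriv_x i L) (x, s, z)"
    and "deriv_x i (deriv_z j L) (x, s, z) = deriv_z j (deriv_x i L) (x, s, z)"
    unfolding deriv_x_def deriv_u_def deriv_z_def by (auto simp: Basis_lagrangian)
qed

lemma continuous_on_jet: "continuous_on \<Omega> (jet u)"
proof (rule differentiable_imp_continuous_on, unfold differentiable_on_def, rule ballI)
  fix x assume "x \<in> \<Omega>"
  with u obtain J where "(jet u has_derivative J) (at x)"
    by (rule has_derivative_jet)
  then show "jet u differentiable (at x within \<Omega>)"
    by (rule differentiable_at_withinI[OF differentiableI])
qed

lemma continuous_on_euler_lagrange: "continuous_on \<Omega> (euler_lagrange L u)"
proof -
  have jet: "continuous_on \<Omega> (\<lambda>x. g (jet u x))"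
    if "continuous_on (\<Omega> \<times> UNIV \<times> UNIV) g" for g :: "'n lagrangian"
    by (rule continuous_on_compose2[OF that continuous_on_jet]) auto
  have L2: "continuous_on \<Omega> (\<lambda>x. partial_deriv c (partial_deriv b L) (jet u x))"
    if "b \<in> Basis" "c \<in> Basis" for b c
    using L that by (intro jet) (auto simp: Ck_on_2_iff)
  have Lu: "continuous_on \<Omega> (\<lambda>x. deriv_u L (jet u x))"
    by (rule jet, rule differentiable_imp_continuous_on)
       (auto simp: differentiable_on_def intro: differentiable_at_withinI differentiable_lagrangian)
  have u1: "continuous_on \<Omega> (partial_deriv (axis j 1) u)" for j
    by (rule differentiable_imp_continuous_on)
       (use u in \<open>auto simp: differentiable_on_def Ck_on_2_iff axis_in_Basis_iff
         intro: differentiable_at_withinI\<close>)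
  have u2: "continuous_on \<Omega> (partial_deriv (axis j 1) (partial_deriv (axis k 1) u))" for j k
    using u by (auto simp: Ck_on_2_iff axis_in_Basis_iff)
  \<comment> \<open>This is the Euler-Lagrange expression expanded by the chain rule, so that only
    derivatives of \<open>L\<close> and \<open>u\<close> up to order two occur, all continuous along
    the jet.\<close>
  have "continuous_on \<Omega> (\<lambda>x. (\<Sum>j\<in>UNIV. deriv_x j (deriv_z j L) (jet u x)
    + partial_deriv (axis j 1) u x * deriv_u (deriv_z j L) (jet u x)
    + (\<Sum>k\<in>UNIV. partial_deriv (axis j 1) (partial_deriv (axis k 1) u) x
        * deriv_z k (deriv_z j L) (jet u x))) - deriv_u L (jet u x))"
    by (intro continuous_intros Lu u1 u2)
       (simp_all add: deriv_x_def deriv_u_def deriv_z_def L2 Basis_lagrangian)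
  then show ?thesis
    by (rule continuous_on_eq)
       (simp add: euler_lagrange_def partial_deriv_compose_jet[OF u] differentiable_lagrangian)
qed

text \<open>The product rule splits the divergence of \<open>u_i L_{z_j}\<close> into
  \<open>u_ij L_{z_j}\<close> and \<open>u_i\<close> times the divergence of \<open>L_z\<close>. The
  Kronecker term contributes minus the total derivative of \<open>L\<close> in direction
  \<open>i\<close>. Expanding it, its \<open>L_{x_i}\<close> cancels the added one and its Hessian
  terms cancel the \<open>u_ij L_{z_j}\<close>; the remaining \<open>- u_i L_u\<close> completes the
  product.\<close>

lemma noether_expression:
  assumes x: "x \<in> \<Omega>"
  shows "(\<Sum>j\<in>UNIV. partial_deriv (axis j 1) (\<lambda>y. energy_momentum L i j (jet u y)) x)
    + deriv_x i L (jet u x) = grad u x $ i * euler_lagrange L u x"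
proof -
  let ?ui = "partial_deriv (axis i 1) u"
  have *: "partial_deriv (axis j 1) (\<lambda>y. energy_momentum L i j (jet u y)) x =
      partial_deriv (axis j 1) ?ui x * deriv_z j L (jet u x)
      + ?ui x * partial_deriv (axis j 1) (\<lambda>y. deriv_z j L (jet u y)) x
      - (if i = j then partial_deriv (axis i 1) (\<lambda>y. L (jet u y)) x else 0)" for j
  proof -
    have "?ui differentiable (at x)"
      using u x by (auto simp: Ck_on_2_iff axis_in_Basis_iff)
    then obtain U where U: "(?ui has_derivative U) (at x)"
      by (auto simp: differentiable_def)
    obtain A where A: "((\<lambda>y. deriv_z j L (jet u y)) has_derivative A) (at x)"
      using differentiable_compose_jet[OF u x differentiable_lagrangian(3)[OF x]]
      by (auto simp: differentiable_def)
    obtain B where B: "((\<lambda>y. L (jet u y)) has_derivative B) (at x)"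
      using differentiable_compose_jet[OF u x differentiable_lagrangian(1)[OF x]]
      by (auto simp: differentiable_def)
    have "((\<lambda>y. ?ui y * deriv_z j L (jet u y) - (if i = j then 1 else 0) * L (jet u y)) has_derivative
        (\<lambda>d. (?ui x * A d + U d * deriv_z j L (jet u x)) - (if i = j then 1 else 0) * B d)) (at x)"
      by (intro has_derivative_diff has_derivative_mult has_derivative_mult_right U A B)
    moreover have "(\<lambda>y. energy_momentum L i j (jet u y)) =
        (\<lambda>y. ?ui y * deriv_z j L (jet u y) - (if i = j then 1 else 0) * L (jet u y))"
      by (simp add: energy_momentum_def grad_def)
    ultimately show ?thesis
      using partial_deriv_has_derivative[OF U, of "axis j 1"]
        partial_deriv_has_derivative[OF A, of "axis j 1"]
        partial_deriv_has_derivative[OF B, of "axis j 1"]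
      by (simp add: partial_deriv_has_derivative)
  qed
  \<comment> \<open>The product rule and the chain rule produce the second derivatives of
    \<open>u\<close> in opposite orders, so the cancellation rests on the symmetry of the
    Hessian.\<close>
  have sym: "partial_deriv (axis j 1) ?ui x =
      partial_deriv (axis i 1) (partial_deriv (axis j 1) u) x" for j
    by (rule partial_deriv_commute[OF \<Omega> x u]) (auto simp: axis_in_Basis_iff)
  have "grad u x $ i = ?ui x"
    by (simp add: grad_def)
  then show ?thesis
    unfolding * sum.distrib sum_subtractf euler_lagrange_def
    by (simp add: partial_deriv_compose_jet[OF u x differentiable_lagrangian(1)[OF x], of i]
        sym algebra_simps sum_distrib_left)
qed

section \<open>The interior of the critical set\<close>

lemma
  assumes x: "x \<in> interior {x \<in> \<Omega>. grad u x = 0}"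
  shows grad_interior: "partial_deriv (axis j 1) u x = 0"
    and second_deriv_interior: "partial_deriv b (partial_deriv (axis k 1) u) x = 0"
proof -
  have zero: "partial_deriv (axis k 1) u y = 0" if "y \<in> interior {x \<in> \<Omega>. grad u x = 0}" for y k
    using that interior_subset by (fastforce simp: grad_def vec_eq_iff)
  from zero[OF x] show "partial_deriv (axis j 1) u x = 0" .
  \<comment> \<open>The interior is open, so the first partials vanish on a whole neighbourhood of
    \<open>x\<close> and can be replaced by the constant zero before differentiating again.\<close>
  have "partial_deriv b (partial_deriv (axis k 1) u) x = partial_deriv b (\<lambda>_. 0) x"
    by (rule partial_deriv_cong, rule eventually_mono[OF eventually_nhds_in_open[OF open_interior x]])
       (rule zero)
  then show "partial_deriv b (partial_deriv (axis k 1) u) x = 0"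
    by (simp add: partial_deriv_def)
qed

text \<open>Since \<open>Du\<close> and \<open>D^2 u\<close> vanish at \<open>x\<close>, the chain
  rule leaves from the divergence of \<open>L_z\<close> only the sum of \<open>L_{x_i z_i}\<close>
  at \<open>z = 0\<close>, which is zero by assumption.\<close>

lemma euler_lagrange_interior:
  assumes "\<forall>x\<in>\<Omega>. \<forall>s. (\<Sum>i\<in>UNIV. deriv_z i (deriv_x i L) (x, s, 0)) = 0"
    and x: "x \<in> interior {x \<in> \<Omega>. grad u x = 0}"
  shows "euler_lagrange L u x = - deriv_u L (jet u x)"
proof -
  have \<Omega>x: "x \<in> \<Omega>" "grad u x = 0"
    using x interior_subset by blast+
  then show ?thesis
    using assms(1)
    by (simp add: euler_lagrange_def partial_deriv_compose_jet[OF u] differentiable_lagrangian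
        grad_interior[OF x] second_deriv_interior[OF x] deriv_commute)
qed

text \<open>Here the chain rule leaves only \<open>L_{x_j u}\<close> at \<open>z = 0\<close> as the
  \<open>j\<close>-th partial derivative, and this vanishes by assumption.\<close>

lemma deriv_u_has_derivative_zero_interior:
  assumes "\<forall>x\<in>\<Omega>. \<forall>s. \<forall>i. deriv_u (deriv_x i L) (x, s, 0) = 0"
    and x: "x \<in> interior {x \<in> \<Omega>. grad u x = 0}"
  shows "((\<lambda>y. deriv_u L (jet u y)) has_derivative (\<lambda>_. 0)) (at x)"
proof (rule has_derivative_zero_if_partial_deriv_zero)
  have \<Omega>x: "x \<in> \<Omega>" "grad u x = 0"
    using x interior_subset by blast+
  then show "(\<lambda>y. deriv_u L (jet u y)) differentiable (at x)"
    by (intro differentiable_compose_jet[OF u] differentiable_lagrangian)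
  fix b :: "real^'n"
  assume "b \<in> Basis"
  then obtain j where "b = axis j 1"
    by (auto simp: Basis_vec_def)
  then show "partial_deriv b (\<lambda>y. deriv_u L (jet u y)) x = 0"
    using assms(1) \<Omega>x
    by (simp add: partial_deriv_compose_jet[OF u] differentiable_lagrangian
        grad_interior[OF x] second_deriv_interior[OF x] deriv_commute)
qed

end

section \<open>The clopen argument for a nonzero level set\<close>

theorem corollary3:
  fixes \<Omega> :: "(real^'n::finite) set"
    and L :: "'n lagrangian"
    and u :: "real^'n \<Rightarrow> real"
  assumes "open \<Omega>" and "connected \<Omega>" and "bounded \<Omega>"
    and "Ck_on 2 (\<Omega> \<times> UNIV \<times> UNIV) L"
    and "C1_closure (\<Omega> \<times> UNIV \<times> UNIV) L"
    and "\<forall>x\<in>\<Omega>. \<forall>s. (\<Sum>i\<in>UNIV. deriv_z i (deriv_x i L) (x, s, 0)) = 0"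
    and "\<forall>x\<in>\<Omega>. \<forall>s. \<forall>i. deriv_u (deriv_x i L) (x, s, 0) = 0"
    and "Ck_on 2 \<Omega> u"
    and "C1_closure \<Omega> u"
    and "\<exists>x\<in>\<Omega>. grad u x \<noteq> 0"
    and "noether_solution \<Omega> L u"
    and "interior {x \<in> \<Omega>. grad u x = 0} \<noteq> {}"
  shows "\<forall>x \<in> interior {x \<in> \<Omega>. grad u x = 0}. deriv_u L (x, u x, grad u x) = 0"
proof (rule ccontr)
  note \<Omega> = \<open>open \<Omega>\<close> and L = \<open>Ck_on 2 (\<Omega> \<times> UNIV \<times> UNIV) L\<close> and u = \<open>Ck_on 2 \<Omega> u\<close>
  let ?A = "{x \<in> \<Omega>. grad u x = 0}" and ?E = "euler_lagrange L u"
  note cont = continuous_on_euler_lagrange[OF \<Omega> L u]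
  assume "\<not> ?thesis"
  then obtain a where a: "a \<in> interior ?A" "deriv_u L (jet u a) \<noteq> 0"
    by blast
  define V where "V = {x \<in> \<Omega>. ?E x = ?E a}"
  have E_a: "?E a \<noteq> 0"
    using euler_lagrange_interior[OF \<Omega> L u assms(6) a(1)] a(2) by simp
  \<comment> \<open>One equation suffices: taken at an index \<open>i\<close> with
    \<open>u_i\<close> nonzero, it allows division by \<open>u_i\<close>.\<close>
  have E_zero: "?E x = 0" if "x \<in> \<Omega>" "grad u x \<noteq> 0" for x
  proof -
    obtain i where "grad u x $ i \<noteq> 0"
      using \<open>grad u x \<noteq> 0\<close> by (auto simp: vec_eq_iff)
    then show ?thesis
      using noether_expression[OF \<Omega> L u \<open>x \<in> \<Omega>\<close>, of i] \<open>noether_solution \<Omega> L u\<close> \<open>x \<in> \<Omega>\<close>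
      by (simp add: noether_solution_def)
  qed
  \<comment> \<open>By \<open>E_zero\<close> this set is contained in \<open>?A\<close>; being open,
    it even lies in the interior, and it contains \<open>V\<close> because \<open>?E a\<close> is
    nonzero.\<close>
  have "open {x \<in> \<Omega>. ?E x \<noteq> 0}"
    using continuous_open_preimage[OF cont \<Omega>, of "- {0}"]
    by (simp add: vimage_def Int_def open_delete Compl_eq_Diff_UNIV)
  then have "{x \<in> \<Omega>. ?E x \<noteq> 0} \<subseteq> interior ?A"
    by (rule interior_maximal[rotated]) (use E_zero in blast)
  then have V_sub: "V \<subseteq> interior ?A"
    using E_a by (auto simp: V_def)
  have "open V"
    unfolding open_contains_ball
  proof
    fix x assume "x \<in> V"
    then obtain r where r: "0 < r" "ball x r \<subseteq> interior ?A"
      using V_sub open_interior open_contains_ball by blast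
    \<comment> \<open>The ball is convex and lies in the interior of \<open>?A\<close>, so the
      vanishing derivative makes \<open>L_u\<close> along the jet constant on it; there
      \<open>?E\<close> is its negative.\<close>
    have "\<exists>c. \<forall>y\<in>ball x r. deriv_u L (jet u y) = c"
      by (rule has_derivative_zero_constant[OF convex_ball])
         (use r deriv_u_has_derivative_zero_interior[OF \<Omega> L u assms(7)] has_derivative_at_withinI
          in blast)
    then obtain c where c: "\<And>y. y \<in> ball x r \<Longrightarrow> deriv_u L (jet u y) = c"
      by blast
    have "?E y = - c" if "y \<in> ball x r" for y
      using euler_lagrange_interior[OF \<Omega> L u assms(6)] c[OF that] r that by (simp add: subset_iff)
    then have "?E y = ?E x" if "y \<in> ball x r" for y
      using that r centre_in_ball by simp
    moreover have "ball x r \<subseteq> \<Omega>"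
      using r interior_subset by blast
    ultimately have "ball x r \<subseteq> V"
      using \<open>x \<in> V\<close> by (auto simp: V_def)
    with r show "\<exists>e>0. ball x e \<subseteq> V"
      by blast
  qed
  then have "openin (top_of_set \<Omega>) V"
    by (simp add: V_def openin_open_eq \<Omega>)
  moreover have "closedin (top_of_set \<Omega>) V"
    unfolding V_def by (rule continuous_closedin_preimage_constant[OF cont])
  ultimately have "V = {} \<or> V = \<Omega>"
    using \<open>connected \<Omega>\<close> by (auto simp: connected_clopen)
  moreover have "a \<in> V"
    using a interior_subset by (auto simp: V_def)
  \<comment> \<open>The point \<open>a\<close> rules out \<open>V = {}\<close>, so \<open>V\<close>
    is all of \<open>\<Omega>\<close> and \<open>Du\<close> would vanish identically.\<close>
  ultimately have "\<Omega> \<subseteq> ?A"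
    using V_sub interior_subset by blast
  with \<open>\<exists>x\<in>\<Omega>. grad u x \<noteq> 0\<close> show False
    by blast
qed

end
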